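(* Let $\mu$ and $\nu$ be tight probabilistic frames on $\mathbb{R}^N$. If $\nu$ has zero mean, i.e., $\int_{\mathbb{R}^N}y\,d\nu(y)=0$, then $\mu\ast\nu$ is also a tight probabilistic frame.
   Context: $\mathbb{R}^N$ carries the standard Euclidean inner product $\langle\cdot,\cdot\rangle$ and norm $\|\cdot\|$. A Borel probability measure $\mu$ on $\mathbb{R}^N$ is a tight probabilistic frame if there is a constant $0<A<\infty$ such that $\int_{\mathbb{R}^N}|\langle x,y\rangle|^2\,d\mu(y)=A\|x\|^2$ for all $x\in\mathbb{R}^N$. The convolution of Borel probability measures $\mu,\nu$ on $\mathbb{R}^N$ is the Borel probability measure $\mu\ast\nu(A)=\int_{\mathbb{R}^N}\mu(A-x)\,d\nu(x)$ for Borel sets $A\subset\mathbb{R}^N$. *)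

theory Defs
  imports "HOL-Probability.Probability"
begin

(* The second-moment integral is a nonnegative Lebesgue integral with values in ennreal, so the
   equation includes its finiteness. *)
definition tight_probabilistic_frame :: "(real ^ 'n) measure \<Rightarrow> bool" where
  "tight_probabilistic_frame \<mu> \<longleftrightarrow>
     prob_space \<mu> \<and> sets \<mu> = sets borel \<and>
     (\<exists>A::real. 0 < A \<and>
        (\<forall>x. (\<integral>\<^sup>+ y. ennreal (\<bar>x \<bullet> y\<bar>\<^sup>2) \<partial>\<mu>) = ennreal (A * (norm x)\<^sup>2)))"

(* The library defines the convolution as the distribution of the sum under the product measure;
   on Borel probability measures it is given by the translation formula. *)
lemma emeasure_convolution_translate:
  fixes \<mu> \<nu> :: "(real ^ 'n) measure"
  assumes "prob_space \<mu>" "sets \<mu> = sets borel"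
    and "prob_space \<nu>" "sets \<nu> = sets borel"
    and "A \<in> sets borel"
  shows "emeasure (\<mu> \<star> \<nu>) A = (\<integral>\<^sup>+ x. emeasure \<mu> ((\<lambda>a. a - x) ` A) \<partial>\<nu>)"
proof -
  have fin: "finite_measure \<mu>" "finite_measure \<nu>"
    using assms by (simp_all add: prob_space.finite_measure)
  have sp: "space \<mu> = space borel" "space \<nu> = space borel"
    using assms sets_eq_imp_space_eq by blast+
  have "(\<lambda>a. a - x) ` A = {a. a + x \<in> A}" for x
    by (force simp: image_iff)
  moreover have "emeasure (\<mu> \<star> \<nu>) A = emeasure (\<nu> \<star> \<mu>) A"
    using convolution_commutative[of \<mu> \<nu>] fin assms by simp
  ultimately show ?thesis
    using convolution_emeasure[of A \<nu> \<mu>] fin assms sp by simp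
qed

end

theory Submission
  imports Defs
begin

text \<open>
  For a random vector \<open>Y\<close> with finite second moments and mean zero, shifting by
  a fixed vector \<open>u\<close> changes the second moment in direction \<open>x\<close> only by \<open>\<langle>x,u\<rangle>\<^sup>2\<close>: the cross
  term in the expansion of \<open>\<langle>x, u + Y\<rangle>\<^sup>2\<close> is \<open>2\<langle>x,u\<rangle>\<langle>x,Y\<rangle>\<close>, whose expectation vanishes
  (lemma \<open>second_moment_translate\<close>). Averaging over \<open>u\<close> with respect to the first measure
  shows that the convolution is tight, and that the two frame constants add up.

  The cross term may be dropped only if the mean is a genuine integral, since the Bochner integral
  of a function that is not integrable is zero by convention. Finite second moments in all
  directions give integrability of the identity (lemma \<open>integrable_id_if_second_moments\<close>).
\<close>

text \<open>
  On a finite measure constants are integrable, so \<open>1 + f\<^sup>2\<close> is an integrable majorant of \<open>\<bar>f\<bar>\<close>.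
\<close>

lemma integrable_if_integrable_square:
  fixes f :: "'a \<Rightarrow> real"
  assumes "finite_measure M" and [measurable]: "f \<in> borel_measurable M"
    and "integrable M (\<lambda>y. (f y)\<^sup>2)"
  shows "integrable M f"
proof (rule Bochner_Integration.integrable_bound)
  interpret finite_measure M by fact
  show "integrable M (\<lambda>y. 1 + (f y)\<^sup>2)"
    using assms(3) by simp
  have "\<bar>t\<bar> \<le> 1 + t\<^sup>2" for t :: real
    using zero_le_power2[of "\<bar>t\<bar> - 1"] by (simp add: power2_diff)
  then show "AE y in M. norm (f y) \<le> norm (1 + (f y)\<^sup>2)"
    by (simp add: add_nonneg_nonneg)
qed measurable

text \<open>The identity is the finite sum of its coordinates, and each coordinate is square integrable.\<close>

lemma integrable_id_if_second_moments:
  fixes M :: "'a::euclidean_space measure"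
  assumes "finite_measure M" and [measurable_cong]: "sets M = sets borel"
    and sq: "\<And>x. integrable M (\<lambda>y. (x \<bullet> y)\<^sup>2)"
  shows "integrable M (\<lambda>y. y)"
proof -
  have "integrable M (\<lambda>y. b \<bullet> y)" for b
    by (rule integrable_if_integrable_square[OF assms(1) _ sq]) measurable
  then have "integrable M (\<lambda>y. \<Sum>b\<in>Basis. (b \<bullet> y) *\<^sub>R b)"
    by (intro Bochner_Integration.integrable_sum integrable_scaleR_left)
  then show ?thesis
    by (simp add: inner_commute[of _ "_::'a"] euclidean_representation)
qed

text \<open>
  The cross term \<open>2\<langle>x,u\<rangle>\<langle>x,y\<rangle>\<close> is linear in \<open>y\<close>, so its integral is a multiple of
  \<open>\<langle>x,\<integral>y\<rangle> = 0\<close>.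
\<close>

lemma second_moment_translate:
  fixes M :: "'a::euclidean_space measure"
  assumes "prob_space M" and [measurable_cong]: "sets M = sets borel"
    and sq: "\<And>x. has_bochner_integral M (\<lambda>y. (x \<bullet> y)\<^sup>2) (q x)"
    and mean: "(\<integral>y. y \<partial>M) = 0"
  shows "has_bochner_integral M (\<lambda>y. (x \<bullet> (u + y))\<^sup>2) ((x \<bullet> u)\<^sup>2 + q x)"
proof -
  interpret prob_space M by fact
  have "integrable M (\<lambda>y. y)"
    using sq by (intro integrable_id_if_second_moments) (auto simp: has_bochner_integral_iff finite_measure_axioms assms(2))
  then have "has_bochner_integral M (\<lambda>y. x \<bullet> y) 0"
    using mean by (simp add: has_bochner_integral_iff)
  then have "has_bochner_integral M
      (\<lambda>y. (x \<bullet> u)\<^sup>2 + 2 * (x \<bullet> u) * (x \<bullet> y) + (x \<bullet> y)\<^sup>2) ((x \<bullet> u)\<^sup>2 + 2 * (x \<bullet> u) * 0 + q x)"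
    using sq[of x] by (simp add: has_bochner_integral_iff prob_space)
  then show ?thesis
    by (simp add: inner_add_right power2_sum algebra_simps)
qed

theorem proposition2:
  fixes \<mu> \<nu> :: "(real ^ 'n) measure"
  assumes "tight_probabilistic_frame \<mu>"
    and "tight_probabilistic_frame \<nu>"
    and "(\<integral>y. y \<partial>\<nu>) = 0"
  shows "tight_probabilistic_frame (\<mu> \<star> \<nu>)"
proof -
  obtain A where "prob_space \<mu>" and sets_\<mu> [measurable_cong]: "sets \<mu> = sets borel" and "0 < A"
    and A: "\<And>x. (\<integral>\<^sup>+ y. ennreal ((x \<bullet> y)\<^sup>2) \<partial>\<mu>) = ennreal (A * (norm x)\<^sup>2)"
    using assms(1) by (auto simp: tight_probabilistic_frame_def)
  obtain B where "prob_space \<nu>" and sets_\<nu> [measurable_cong]: "sets \<nu> = sets borel" and "0 < B"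
    and B: "\<And>x. (\<integral>\<^sup>+ y. ennreal ((x \<bullet> y)\<^sup>2) \<partial>\<nu>) = ennreal (B * (norm x)\<^sup>2)"
    using assms(2) by (auto simp: tight_probabilistic_frame_def)
  interpret \<mu>: prob_space \<mu> by fact
  interpret \<nu>: prob_space \<nu> by fact
  interpret pair_prob_space \<mu> \<nu> ..
  have "prob_space (\<mu> \<star> \<nu>)"
    unfolding convolution_def by (rule prob_space_distr) measurable
  moreover have "(\<integral>\<^sup>+ y. ennreal (\<bar>x \<bullet> y\<bar>\<^sup>2) \<partial>(\<mu> \<star> \<nu>)) = ennreal ((A + B) * (norm x)\<^sup>2)" for x
  proof -
    have "has_bochner_integral \<nu> (\<lambda>y. (z \<bullet> y)\<^sup>2) (B * (norm z)\<^sup>2)" for z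
      using \<open>0 < B\<close> B by (intro has_bochner_integral_nn_integral) auto
    note translate = second_moment_translate[OF \<open>prob_space \<nu>\<close> sets_\<nu> this assms(3)]
    have inner: "(\<integral>\<^sup>+ y. ennreal ((x \<bullet> (u + y))\<^sup>2) \<partial>\<nu>)
        = ennreal ((x \<bullet> u)\<^sup>2) + ennreal (B * (norm x)\<^sup>2)" for u
      using translate[of x u] \<open>0 < B\<close>
      by (simp add: has_bochner_integral_iff nn_integral_eq_integral)
    have "(\<integral>\<^sup>+ y. ennreal (\<bar>x \<bullet> y\<bar>\<^sup>2) \<partial>(\<mu> \<star> \<nu>))
        = (\<integral>\<^sup>+ u. \<integral>\<^sup>+ y. ennreal ((x \<bullet> (u + y))\<^sup>2) \<partial>\<nu> \<partial>\<mu>)"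
      by (subst nn_integral_convolution)
        (simp_all add: \<mu>.finite_measure_axioms \<nu>.finite_measure_axioms sets_\<mu> sets_\<nu>)
    also have "\<dots> = (\<integral>\<^sup>+ u. ennreal ((x \<bullet> u)\<^sup>2) \<partial>\<mu>) + ennreal (B * (norm x)\<^sup>2)"
      by (simp add: inner nn_integral_add \<mu>.emeasure_space_1)
    also have "\<dots> = ennreal ((A + B) * (norm x)\<^sup>2)"
      using \<open>0 < A\<close> \<open>0 < B\<close> by (simp add: A distrib_right)
    finally show ?thesis .
  qed
  ultimately show ?thesis
    using \<open>0 < A\<close> \<open>0 < B\<close> unfolding tight_probabilistic_frame_def
    by (auto intro!: exI[of _ "A + B"])
qed

end
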